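(* Let $n \geq 2$ be an integer and let $p_0, \dotsc, p_{n-1}$ be positive rational numbers summing to $1$, with $p_i = a_i / b_i$ in lowest terms. Let $d = \mathrm{lcm}(b_0, \dotsc, b_{n-1})$, and let $g$ be the base-$n$ block of length $d$ consisting of $p_0 d$ copies of $0$, followed by $p_1 d$ copies of $1$, \dots, followed by $p_{n-1} d$ copies of $n-1$ (digits in increasing order). Let $\nu \in d^{\omega}$ be a base-$d$ normal sequence, and define $\beta \in n^{\omega}$ by $\beta[k] = g[\nu[k]]$ for all $k$. Then $\beta$ is biased normal with respect to $p_0, \dotsc, p_{n-1}$.
   Context: Sequences are indexed from $0$; $\sigma[i:j]$ denotes the entries from index $i$ to $j$ inclusive, and $\mathrm{occ}(\sigma,\rho)$ is the number of (possibly overlapping) occurrences of block $\rho$ in $\sigma$. A sequence $\nu \in d^{\omega}$ is normal (in base $d$) if every block $u$ of length $\ell$ over $\{0,\dotsc,d-1\}$ satisfies $\lim_{k\to\infty}\mathrm{occ}(\nu[0:k-1],u)/k = d^{-\ell}$, for every $\ell \geq 1$. A sequence $x \in n^{\omega}$, identified with the real $\sum_{i\ge1} x[i-1] n^{-i}$, is biased normal with respect to $p_0,\dotsc,p_{n-1}$ if for every integer $m\ge0$ and every positive integer $k$, the real $n^m x$ (taken modulo $1$) is biased simply normal in base $n^k$ to the biases $p^*_{k,i} = \prod_{j=0}^{k-1} p_{(i)_n[j]}$ ($0 \le i < n^k$, $(i)_n$ zero-padded to $k$ digits); here a real $y$ is biased simply normal in base $B$ to biases $q_0,\dotsc,q_{B-1}$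 if each digit $e$ occurs with limiting frequency $q_e$ in the base-$B$ digit sequence of the fractional part of $y$ (the expansion with infinitely many digits different from $B-1$). Equivalently (as established in the paper), $x$ is biased normal iff for every $r\ge1$ and every block $v$ of length $r$, $\lim_{k\to\infty}\mathrm{occ}(x[0:k-1],v)/k = \prod_{j=0}^{r-1} p_{v[j]}$. *)

theory Defs
  imports Complex_Main
begin

text \<open>
  An infinite sequence over the digits \<open>0, \<dots>, b - 1\<close> is a function \<^typ>\<open>nat \<Rightarrow> nat\<close> all of whose
  values are below \<open>b\<close>; a block is a list of digits.
\<close>

definition digit_seq :: "nat \<Rightarrow> (nat \<Rightarrow> nat) \<Rightarrow> bool" where
  "digit_seq b \<sigma> \<longleftrightarrow> (\<forall>i. \<sigma> i < b)"

definition seq_prefix :: "(nat \<Rightarrow> nat) \<Rightarrow> nat \<Rightarrow> nat list" where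
  "seq_prefix \<sigma> k = map \<sigma> [0..<k]"

definition occ :: "nat list \<Rightarrow> nat list \<Rightarrow> nat" where
  "occ \<sigma> \<rho> = card {i. i + length \<rho> \<le> length \<sigma> \<and> take (length \<rho>) (drop i \<sigma>) = \<rho>}"

definition normal_seq :: "nat \<Rightarrow> (nat \<Rightarrow> nat) \<Rightarrow> bool" where
  "normal_seq d \<nu> \<longleftrightarrow> digit_seq d \<nu> \<and>
     (\<forall>l\<ge>1. \<forall>u. length u = l \<and> set u \<subseteq> {..<d} \<longrightarrow>
        (\<lambda>k. real (occ (seq_prefix \<nu> k) u) / real k) \<longlonglongrightarrow> 1 / real d ^ l)"

text \<open>The real number that a base-\<open>n\<close> sequence is identified with.\<close>

definition real_of_digits :: "nat \<Rightarrow> (nat \<Rightarrow> nat) \<Rightarrow> real" where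
  "real_of_digits n x = (\<Sum>i. real (x i) / real n ^ Suc i)"

text \<open>
  For \<open>B \<ge> 2\<close> and \<open>0 \<le> y < 1\<close> there is exactly one such \<open>s\<close>: the last conjunct
  excludes expansions ending in repeated digits \<open>B - 1\<close>.
\<close>

definition radix_expansion :: "nat \<Rightarrow> real \<Rightarrow> (nat \<Rightarrow> nat) \<Rightarrow> bool" where
  "radix_expansion B y s \<longleftrightarrow> digit_seq B s \<and>
     (\<lambda>i. real (s i) / real B ^ Suc i) sums y \<and> infinite {i. s i \<noteq> B - 1}"

definition biased_simply_normal :: "nat \<Rightarrow> (nat \<Rightarrow> real) \<Rightarrow> real \<Rightarrow> bool" where
  "biased_simply_normal B q y \<longleftrightarrow>
     (\<exists>s. radix_expansion B (frac y) s \<and>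
        (\<forall>e<B. (\<lambda>k. real (card {i. i < k \<and> s i = e}) / real k) \<longlonglongrightarrow> q e))"

text \<open>
  The base-\<open>n\<close> representation of \<open>i < n ^ k\<close>, most significant digit first and padded with
  leading zeros to length \<open>k\<close>.
\<close>

definition padded_digits :: "nat \<Rightarrow> nat \<Rightarrow> nat \<Rightarrow> nat list" where
  "padded_digits n k i = map (\<lambda>j. (i div n ^ (k - 1 - j)) mod n) [0..<k]"

definition block_bias :: "nat \<Rightarrow> (nat \<Rightarrow> real) \<Rightarrow> nat \<Rightarrow> nat \<Rightarrow> real" where
  "block_bias n p k i = (\<Prod>j<k. p (padded_digits n k i ! j))"

definition biased_normal :: "nat \<Rightarrow> (nat \<Rightarrow> real) \<Rightarrow> (nat \<Rightarrow> nat) \<Rightarrow> bool" where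
  "biased_normal n p x \<longleftrightarrow> digit_seq n x \<and>
     (\<forall>m. \<forall>k\<ge>1. biased_simply_normal (n ^ k) (block_bias n p k)
        (real n ^ m * real_of_digits n x))"

text \<open>
  \<open>p i * d\<close> copies of each digit \<open>i < n\<close>, in increasing order of digits. The floor only
  converts to a natural number: in use \<open>d\<close> is a common denominator of the \<open>p i\<close>, so
  that \<open>p i * d\<close> is already an integer.
\<close>

definition bias_block :: "nat \<Rightarrow> (nat \<Rightarrow> real) \<Rightarrow> nat \<Rightarrow> nat list" where
  "bias_block n p d = concat (map (\<lambda>i. replicate (nat \<lfloor>p i * real d\<rfloor>) i) [0..<n])"

end

theory Submission
  imports Defs "HOL-Analysis.Convex"
begin

text \<open>
  Base-\<open>n ^ k\<close> digits of \<open>n ^ m * x\<close> are the disjoint blocks of length \<open>k\<close> of \<open>x\<close> starting at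
  position \<open>m\<close>, whereas normality of \<open>\<nu>\<close> controls overlapping blocks. To pass from all positions to a
  residue class, note that whether \<open>\<nu>\<close> shows a block from \<open>S\<close> at position \<open>j\<close> and whether it does
  at \<open>j + t * k\<close> are asymptotically independent events for \<open>t \<ge> 1\<close>, because together they amount
  to a set of overlapping blocks of length \<open>(t + 1) * k\<close>. A van der Corput argument turns these
  vanishing correlations into equidistribution along \<open>m + i * k\<close>. A block \<open>v\<close> of \<open>\<beta>\<close> comes from
  \<open>\<Prod>j. p (v ! j) * d\<close> blocks of \<open>\<nu>\<close>, which gives the biases.
\<close>

section \<open>Averages over initial segments and their limits\<close>

definition avg :: "(nat \<Rightarrow> real) \<Rightarrow> nat \<Rightarrow> real" where
  "avg x N = (\<Sum>j<N. x j) / real N"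

text \<open>The quotient is \<open>f (N + h) / real (N + h)\<close> times
  \<open>1 + real h / real N\<close>, a factor tending to 1. This absorbs the offset between the
  length of a prefix and the number of positions at which a block can start in it.\<close>

lemma ratio_shift_tendsto:
  fixes f :: "nat \<Rightarrow> real"
  assumes "(\<lambda>N. f N / real N) \<longlonglongrightarrow> l"
  shows "(\<lambda>N. f (N + h) / real N) \<longlonglongrightarrow> l"
proof -
  have "(\<lambda>N. f (N + h) / real (N + h)) \<longlonglongrightarrow> l"
    using assms by (rule LIMSEQ_ignore_initial_segment)
  moreover have "(\<lambda>N. 1 + real h / real N) \<longlonglongrightarrow> 1 + 0"
    by (intro tendsto_intros lim_const_over_n)
  ultimately have "(\<lambda>N. f (N + h) / real (N + h) * (1 + real h / real N)) \<longlonglongrightarrow> l * (1 + 0)"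
    by (rule tendsto_mult)
  moreover have "\<forall>\<^sub>F N in sequentially.
      f (N + h) / real (N + h) * (1 + real h / real N) = f (N + h) / real N"
    using eventually_gt_at_top[of 0]
  proof eventually_elim
    case (elim N)
    then have "1 + real h / real N = real (N + h) / real N" by (simp add: field_simps)
    then show ?case using elim by simp
  qed
  ultimately show ?thesis
    by (simp add: Lim_transform_eventually)
qed

lemma avg_shift_tendsto:
  assumes "(avg x) \<longlonglongrightarrow> l"
  shows "(avg (\<lambda>j. x (j + h))) \<longlonglongrightarrow> l"
proof -
  have eq: "(\<Sum>j<N. x (j + h)) = (\<Sum>j<N + h. x j) - (\<Sum>j<h. x j)" for N
    by (induction N) simp_all
  have "(\<lambda>N. (\<Sum>j<N + h. x j) / real N - (\<Sum>j<h. x j) / real N) \<longlonglongrightarrow> l - 0"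
    by (intro tendsto_diff ratio_shift_tendsto[of "\<lambda>N. \<Sum>j<N. x j"] lim_const_over_n
        assms[unfolded avg_def])
  then show ?thesis
    by (simp add: avg_def[abs_def] eq diff_divide_distrib)
qed

lemma avg_add_tendsto:
  assumes "(avg x) \<longlonglongrightarrow> l" "(avg y) \<longlonglongrightarrow> l'"
  shows "(avg (\<lambda>j. x j + y j)) \<longlonglongrightarrow> l + l'"
  using tendsto_add[OF assms] by (simp add: avg_def[abs_def] sum.distrib add_divide_distrib)

lemma avg_cmult_tendsto:
  assumes "(avg x) \<longlonglongrightarrow> l"
  shows "(avg (\<lambda>j. c * x j)) \<longlonglongrightarrow> c * l"
  using tendsto_mult_left[OF assms, of c] by (simp add: avg_def[abs_def] sum_distrib_left)

lemma avg_const_tendsto: "(avg (\<lambda>j. c)) \<longlonglongrightarrow> c"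
proof (rule Lim_transform_eventually[OF tendsto_const])
  show "\<forall>\<^sub>F N in sequentially. c = avg (\<lambda>j. c) N"
    using eventually_gt_at_top[of 0] by eventually_elim (simp add: avg_def)
qed

lemma avg_sum_tendsto:
  assumes "\<And>i. i \<in> I \<Longrightarrow> (avg (x i)) \<longlonglongrightarrow> l i"
  shows "(avg (\<lambda>j. \<Sum>i\<in>I. x i j)) \<longlonglongrightarrow> (\<Sum>i\<in>I. l i)"
  using assms
proof (induction I rule: infinite_finite_induct)
  case (insert i I)
  then show ?case by (simp add: avg_add_tendsto)
qed (use avg_const_tendsto[of 0] in simp_all)

section \<open>Vanishing correlations and averages along an arithmetic progression\<close>

lemma sum_shift_diff_le:
  fixes y :: "nat \<Rightarrow> real"
  assumes "\<And>i. \<bar>y i\<bar> \<le> 1"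
  shows "\<bar>(\<Sum>i<N. y (i + r)) - (\<Sum>i<N. y i)\<bar> \<le> 2 * real r"
proof (induction r)
  case (Suc r)
  \<comment> \<open>One more shift drops \<open>y r\<close> and appends \<open>y (N + r)\<close>.
    The cost does not depend on \<open>N\<close>, so it vanishes after division by
    \<open>N\<close>.\<close>
  have "(\<Sum>i<N. y (i + Suc r)) - (\<Sum>i<N. y (i + r)) = y (N + r) - y r"
    by (induction N) simp_all
  moreover have "\<bar>y (N + r) - y r\<bar> \<le> 2"
    using assms[of "N + r"] assms[of r] by linarith
  ultimately show ?case using Suc by simp
qed simp

text \<open>A form of van der Corput's inequality. After averaging over windows of \<open>R\<close> terms
  and applying Cauchy--Schwarz, the summands are squares, so the sum over the progression is at
  most the sum over all indices, where only the diagonal correlations survive.\<close>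
lemma avg_progression_tendsto_0:
  fixes x :: "nat \<Rightarrow> real"
  assumes bounded: "\<And>j. \<bar>x j\<bar> \<le> 1"
    and corr: "\<And>t. t \<ge> 1 \<Longrightarrow> (avg (\<lambda>j. x j * x (j + t * k))) \<longlonglongrightarrow> 0"
    and "k \<ge> 1"
  shows "(avg (\<lambda>i. x (m + i * k))) \<longlonglongrightarrow> 0"
proof -
  define y where "y = (\<lambda>i. x (m + i * k))"
  have y1: "\<bar>y i\<bar> \<le> 1" for i using bounded by (simp add: y_def)
  have main: "\<forall>\<^sub>F N in sequentially. \<bar>avg y N\<bar> \<le> 2 * real R / real N + sqrt (2 * (real k + 1) / real R)"
    if "R \<ge> 1" for R
  proof -
    \<comment> \<open>\<open>Z j\<close> is defined for every start \<open>j\<close>, on or off the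
      progression; being a square, it may be summed over a larger index set to get an upper
      bound.\<close>
    define Z where "Z = (\<lambda>j. (\<Sum>r<R. x (j + r * k))\<^sup>2)"
    define l where "l = (\<lambda>r r' :: nat. if r = r' then 1 else 0 :: real)"
    \<comment> \<open>The average of the squares \<open>x j * x j\<close> is not assumed to
      converge, so each diagonal term is replaced by its upper bound 1. The off-diagonal terms are
      shifted copies of \<open>corr\<close>.\<close>
    have corr': "(avg (\<lambda>j. if r = r' then 1 else x (j + r * k) * x (j + r' * k))) \<longlonglongrightarrow> l r r'" for r r'
    proof -
      consider "r = r'" | "r < r'" | "r' < r" by linarith
      then show ?thesis
      proof cases
        case 1
        then show ?thesis using avg_const_tendsto by (simp add: l_def)
      next
        case 2
        then have "r * k + (r' - r) * k = r' * k"
          by (simp flip: distrib_right)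
        then show ?thesis
          using 2 avg_shift_tendsto[OF corr[of "r' - r"], of "r * k"] by (simp add: l_def add.assoc)
      next
        case 3
        then have "r' * k + (r - r') * k = r * k"
          by (simp flip: distrib_right)
        then show ?thesis
          using 3 avg_shift_tendsto[OF corr[of "r - r'"], of "r' * k"]
          by (simp add: l_def add.assoc mult.commute)
      qed
    qed
    define Z' where "Z' = (\<lambda>j. \<Sum>r<R. \<Sum>r'<R. if r = r' then 1 else x (j + r * k) * x (j + r' * k))"
    have "(avg Z') \<longlonglongrightarrow> (\<Sum>r<R. \<Sum>r'<R. l r r')"
      unfolding Z'_def by (intro avg_sum_tendsto corr')
    also have "(\<Sum>r<R. \<Sum>r'<R. l r r') = real R"
      by (simp add: l_def)
    finally have limZ': "(avg Z') \<longlonglongrightarrow> real R" .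
    have ZZ': "Z j \<le> Z' j" for j
    proof -
      have "Z j = (\<Sum>r<R. \<Sum>r'<R. x (j + r * k) * x (j + r' * k))"
        by (simp add: Z_def power2_eq_square sum_product)
      also have "\<dots> \<le> Z' j"
        unfolding Z'_def using bounded
        by (intro sum_mono) (auto simp: abs_square_le_1 simp flip: power2_eq_square)
      finally show ?thesis .
    qed
    \<comment> \<open>The bound on \<open>avg Z'\<close> is applied at length
      \<open>m + N * k\<close>, which lies beyond every index \<open>m + i * k\<close> with
      \<open>i < N\<close>.\<close>
    have lim: "filterlim (\<lambda>N. m + N * k) at_top sequentially"
      by (rule filterlim_at_top_mono[OF filterlim_ident])
         (use \<open>k \<ge> 1\<close> in \<open>auto intro!: always_eventually trans_le_add2\<close>)
    \<comment> \<open>The factor 2 is slack above the limit \<open>real R\<close>.\<close>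
    have "\<forall>\<^sub>F M in sequentially. avg Z' M < 2 * real R"
      using limZ' \<open>R \<ge> 1\<close> by (intro order_tendstoD) auto
    then have ev: "\<forall>\<^sub>F N in sequentially. avg Z' (m + N * k) < 2 * real R"
      using lim by (rule eventually_compose_filterlim)
    show ?thesis
      using ev eventually_ge_at_top[of "max 1 m"]
    proof eventually_elim
      case (elim N)
      \<comment> \<open>\<open>m \<le> N\<close> yields \<open>m + N * k \<le> N * (k + 1)\<close>
        below.\<close>
      then have N: "N \<ge> 1" "m \<le> N" by auto
      define T where "T = (\<Sum>i<N. \<Sum>r<R. y (i + r))"
      \<comment> \<open>\<open>T\<close> consists of \<open>R\<close> shifted copies of the sum of
        \<open>y\<close>, each off by at most \<open>2 * R\<close>; so \<open>T / (R * N)\<close>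
        approximates \<open>avg y N\<close> with error at most \<open>2 * R / N\<close>.\<close>
      have "\<bar>T - real R * (\<Sum>i<N. y i)\<bar> = \<bar>\<Sum>r<R. (\<Sum>i<N. y (i + r)) - (\<Sum>i<N. y i)\<bar>"
        by (subst sum_subtractf) (simp add: T_def sum.swap[of _ "{..<N}"])
      also have "\<dots> \<le> (\<Sum>r<R. \<bar>(\<Sum>i<N. y (i + r)) - (\<Sum>i<N. y i)\<bar>)"
        by (rule sum_abs)
      also have "\<dots> \<le> (\<Sum>r<R. 2 * real R)"
        by (intro sum_mono order_trans[OF sum_shift_diff_le]) (auto simp: y1)
      finally have shift: "\<bar>T - real R * (\<Sum>i<N. y i)\<bar> \<le> 2 * real R * real R"
        by simp
      have "(\<Sum>i<N. (\<Sum>r<R. y (i + r))\<^sup>2) = (\<Sum>i<N. Z (m + i * k))"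
        by (simp add: Z_def y_def algebra_simps)
      \<comment> \<open>Since \<open>k \<ge> 1\<close>, the progression visits distinct indices
        below \<open>m + N * k\<close>; the missing indices only add nonnegative terms.\<close>
      also have "\<dots> = (\<Sum>j\<in>(\<lambda>i. m + i * k) ` {..<N}. Z j)"
        using \<open>k \<ge> 1\<close> by (subst sum.reindex) (auto simp: inj_on_def)
      also have "\<dots> \<le> (\<Sum>j<m + N * k. Z j)"
        using \<open>k \<ge> 1\<close> by (intro sum_mono2) (auto simp: Z_def)
      also have "\<dots> \<le> (\<Sum>j<m + N * k. Z' j)"
        by (intro sum_mono ZZ')
      also have "\<dots> \<le> 2 * real R * real (m + N * k)"
      proof -
        have "real (m + N * k) > 0" using N \<open>k \<ge> 1\<close> by (simp only: of_nat_0_less_iff) simp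
        then show ?thesis using elim(1) unfolding avg_def by (simp only: pos_divide_less_eq)
      qed
      also have "\<dots> \<le> 2 * real R * (real N * (real k + 1))"
        using N by (intro mult_left_mono) (simp_all add: algebra_simps)
      finally have squares: "(\<Sum>i<N. (\<Sum>r<R. y (i + r))\<^sup>2) \<le> 2 * real R * (real N * (real k + 1))" .
      have "T\<^sup>2 \<le> real N * (\<Sum>i<N. (\<Sum>r<R. y (i + r))\<^sup>2)"
        unfolding T_def using sum_squared_le_sum_of_squares[of "\<lambda>i. \<Sum>r<R. y (i + r)" "{..<N}"]
        by (simp add: mult.commute)
      also have "\<dots> \<le> real N * (2 * real R * (real N * (real k + 1)))"
        by (intro mult_left_mono squares) simp
      finally have T2: "T\<^sup>2 \<le> real N * (2 * real R * (real N * (real k + 1)))" .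
      \<comment> \<open>Both powers of \<open>N\<close> cancel, leaving a bound that is small for
        large \<open>R\<close> uniformly in \<open>N\<close>.\<close>
      have "(T / (real R * real N))\<^sup>2 = T\<^sup>2 / ((real R)\<^sup>2 * (real N)\<^sup>2)"
        by (simp add: power_divide power_mult_distrib)
      also have "\<dots> \<le> real N * (2 * real R * (real N * (real k + 1))) / ((real R)\<^sup>2 * (real N)\<^sup>2)"
        by (intro divide_right_mono T2) simp
      also have "\<dots> = 2 * (real k + 1) / real R"
        using N \<open>R \<ge> 1\<close> by (simp add: field_simps power2_eq_square)
      finally have a: "\<bar>T / (real R * real N)\<bar> \<le> sqrt (2 * (real k + 1) / real R)"
        by (intro real_le_rsqrt) (simp only: power2_abs)
      have "avg y N - T / (real R * real N) = - (T - real R * (\<Sum>i<N. y i)) / (real R * real N)"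
        using N \<open>R \<ge> 1\<close> by (simp add: avg_def field_simps)
      then have "\<bar>avg y N - T / (real R * real N)\<bar> = \<bar>T - real R * (\<Sum>i<N. y i)\<bar> / (real R * real N)"
        by (simp add: abs_divide abs_minus_commute)
      also have "\<dots> \<le> 2 * real R * real R / (real R * real N)"
        by (intro divide_right_mono shift) simp
      also have "\<dots> = 2 * real R / real N"
        using \<open>R \<ge> 1\<close> by simp
      finally have "\<bar>avg y N - T / (real R * real N)\<bar> + \<bar>T / (real R * real N)\<bar>
          \<le> 2 * real R / real N + sqrt (2 * (real k + 1) / real R)"
        using a by (rule add_mono)
      then show ?case
        using abs_triangle_ineq[of "avg y N - T / (real R * real N)" "T / (real R * real N)"] by simp
    qed
  qed
  have "(avg y) \<longlonglongrightarrow> 0"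
  proof (rule tendstoI)
    fix e :: real assume "e > 0"
    \<comment> \<open>The order of choices matters: \<open>R\<close> is fixed first to control the
      square root, and only then does \<open>N\<close> grow to control
      \<open>2 * R / N\<close>.\<close>
    have "(\<lambda>R. sqrt (2 * (real k + 1) / real R)) \<longlonglongrightarrow> sqrt 0"
      by (intro tendsto_real_sqrt lim_const_over_n)
    then have "\<forall>\<^sub>F R in sequentially. sqrt (2 * (real k + 1) / real R) < e / 2"
      using \<open>e > 0\<close> by (intro order_tendstoD) auto
    then have "\<forall>\<^sub>F R in sequentially. R \<ge> 1 \<and> sqrt (2 * (real k + 1) / real R) < e / 2"
      using eventually_ge_at_top[of 1] by eventually_elim simp
    then obtain R where R: "R \<ge> 1" "sqrt (2 * (real k + 1) / real R) < e / 2"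
      by (auto simp: eventually_sequentially)
    have "\<forall>\<^sub>F N in sequentially. 2 * real R / real N < e / 2"
      using \<open>e > 0\<close> by (intro order_tendstoD[OF lim_const_over_n]) auto
    then show "\<forall>\<^sub>F N in sequentially. dist (avg y N) 0 < e"
      using main[OF R(1)] by eventually_elim (use R(2) in \<open>auto simp: dist_real_def\<close>)
  qed
  then show ?thesis by (simp add: y_def)
qed

section \<open>Words, windows and block frequencies in a normal sequence\<close>

definition words :: "nat \<Rightarrow> nat \<Rightarrow> nat list set" where
  "words d L = {u. length u = L \<and> set u \<subseteq> {..<d}}"

lemma finite_words [simp]: "finite (words d L)"
  using finite_lists_length_eq[of "{..<d}" L] by (simp add: words_def conj_commute)

lemma card_words: "card (words d L) = d ^ L"
  using card_lists_length_eq[of "{..<d}" L] by (simp add: words_def conj_commute)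

definition window :: "(nat \<Rightarrow> nat) \<Rightarrow> nat \<Rightarrow> nat \<Rightarrow> nat list" where
  "window \<sigma> j L = map \<sigma> [j..<j + L]"

lemma length_window [simp]: "length (window \<sigma> j L) = L"
  by (simp add: window_def)

lemma window_nth [simp]: "i < L \<Longrightarrow> window \<sigma> j L ! i = \<sigma> (j + i)"
  by (simp add: window_def)

lemma window_append: "window \<sigma> j (L + M) = window \<sigma> j L @ window \<sigma> (j + L) M"
  by (intro nth_equalityI) (auto simp: nth_append)

lemma window_in_words: "digit_seq d \<sigma> \<Longrightarrow> window \<sigma> j L \<in> words d L"
  by (auto simp: words_def window_def digit_seq_def)

lemma avg_of_bool: "avg (\<lambda>j. of_bool (P j)) N = real (card {j. j < N \<and> P j}) / real N"
proof -
  have "{..<N} \<inter> {j. P j} = {j. j < N \<and> P j}" by auto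
  then show ?thesis by (simp add: avg_def sum_of_bool_eq)
qed

text \<open>With \<open>length u - 1\<close> extra letters, the prefix has exactly \<open>N\<close>
  starting positions for \<open>u\<close>. Occurrence counts thus become averages of
  indicators.\<close>

lemma occ_seq_prefix:
  assumes "length u \<ge> 1"
  shows "occ (seq_prefix \<sigma> (N + (length u - 1))) u = card {j. j < N \<and> window \<sigma> j (length u) = u}"
proof -
  let ?M = "N + (length u - 1)"
  have "take (length u) (drop i (seq_prefix \<sigma> ?M)) = window \<sigma> i (length u)"
    if "i + length u \<le> ?M" for i
    using that by (intro nth_equalityI) (auto simp: seq_prefix_def)
  then have "{i. i + length u \<le> length (seq_prefix \<sigma> ?M) \<and>
      take (length u) (drop i (seq_prefix \<sigma> ?M)) = u} = {j. j < N \<and> window \<sigma> j (length u) = u}"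
    using assms by (auto simp: seq_prefix_def)
  then show ?thesis by (simp add: occ_def)
qed

text \<open>The indicator of \<open>S\<close> is the sum of the indicators of its finitely many
  words, each of frequency \<open>1 / d ^ L\<close>.\<close>

lemma normal_seq_avg_window:
  assumes "normal_seq d \<sigma>" "L \<ge> 1" "S \<subseteq> words d L"
  shows "(avg (\<lambda>j. of_bool (window \<sigma> j L \<in> S))) \<longlonglongrightarrow> real (card S) / real d ^ L"
proof -
  have single: "(avg (\<lambda>j. of_bool (window \<sigma> j L = u))) \<longlonglongrightarrow> 1 / real d ^ L" if "u \<in> S" for u
  proof -
    from that assms have u: "length u = L" "set u \<subseteq> {..<d}" by (auto simp: words_def)
    let ?f = "\<lambda>k. real (occ (seq_prefix \<sigma> k) u) / real k"
    have "?f \<longlonglongrightarrow> 1 / real d ^ L"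
      using assms u by (auto simp: normal_seq_def)
    then have "(\<lambda>N. real (occ (seq_prefix \<sigma> (N + (L - 1))) u) / real N) \<longlonglongrightarrow> 1 / real d ^ L"
      by (rule ratio_shift_tendsto)
    then show ?thesis
      using occ_seq_prefix[of u \<sigma>] u assms(2) by (simp add: avg_of_bool[abs_def])
  qed
  have "finite S" using assms(3) finite_words by (rule finite_subset)
  then have "(\<Sum>u\<in>S. of_bool (w = u)) = (of_bool (w \<in> S) :: real)" for w
    by (simp add: of_bool_def)
  then show ?thesis
    using avg_sum_tendsto[of S "\<lambda>u j. of_bool (window \<sigma> j L = u)", OF single] by simp
qed

text \<open>\<open>avg_progression_tendsto_0\<close> is applied to the indicator \<open>e\<close> of
  \<open>S\<close> centred by its density \<open>q\<close>. Pair frequencies \<open>q * q\<close>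
  make all correlations of the centred sequence at shifts \<open>t * k\<close> vanish.\<close>

lemma normal_seq_avg_window_progression:
  assumes \<sigma>: "normal_seq d \<sigma>" and k: "k \<ge> 1" and S: "S \<subseteq> words d k"
  shows "(avg (\<lambda>i. of_bool (window \<sigma> (m + i * k) k \<in> S))) \<longlonglongrightarrow> real (card S) / real d ^ k"
proof -
  define q where "q = real (card S) / real d ^ k"
  define e :: "nat \<Rightarrow> real" where "e = (\<lambda>j. of_bool (window \<sigma> j k \<in> S))"
  have d: "d > 0" using \<sigma> by (auto simp: normal_seq_def digit_seq_def intro: gr_zeroI)
  have dig: "digit_seq d \<sigma>" using \<sigma> by (simp add: normal_seq_def)
  have finS: "finite S" using S finite_words by (rule finite_subset)
  have q: "0 \<le> q" "q \<le> 1"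
    using card_mono[OF finite_words S] d
    by (auto simp: q_def card_words simp flip: of_nat_power)
  have e: "(avg e) \<longlonglongrightarrow> q"
    unfolding e_def q_def by (rule normal_seq_avg_window[OF \<sigma> k S])
  have pair: "(avg (\<lambda>j. e j * e (j + t * k))) \<longlonglongrightarrow> q * q" if "t \<ge> 1" for t
  proof -
    define f where "f = (\<lambda>(u :: nat list, w, v). u @ w @ v)"
    define X where "X = S \<times> words d ((t - 1) * k) \<times> S"
    have len: "length u = k" "length v = k" "length w = (t - 1) * k"
      if "(u, w, v) \<in> X" for u v w
      using that S by (auto simp: X_def words_def)
    have inj: "inj_on f X"
      using len by (auto simp: inj_on_def f_def)
    have tk: "k + ((t - 1) * k + k) = (t + 1) * k" "k + (t - 1) * k = t * k"
      using that by (cases t; simp)+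
    have sub: "f ` X \<subseteq> words d ((t + 1) * k)"
      proof
      fix w' assume "w' \<in> f ` X"
      then obtain u w v where X: "(u, w, v) \<in> X" and w': "w' = u @ w @ v"
        by (auto simp: f_def)
      from X S have "set u \<subseteq> {..<d}" "set w \<subseteq> {..<d}" "set v \<subseteq> {..<d}"
        by (auto simp: X_def words_def)
      then show "w' \<in> words d ((t + 1) * k)"
        using len[OF X] tk(1) by (simp add: words_def w')
    qed
    have "window \<sigma> j ((t + 1) * k) \<in> f ` X \<longleftrightarrow> window \<sigma> j k \<in> S \<and> window \<sigma> (j + t * k) k \<in> S" for j
    proof -
      have w: "window \<sigma> j ((t + 1) * k)
          = f (window \<sigma> j k, window \<sigma> (j + k) ((t - 1) * k), window \<sigma> (j + t * k) k)"
        unfolding tk(1)[symmetric] window_append f_def tk(2)[symmetric] by (simp add: add.assoc)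
      show ?thesis
      proof
        assume "window \<sigma> j ((t + 1) * k) \<in> f ` X"
        then obtain u x v where "(u, x, v) \<in> X" "window \<sigma> j ((t + 1) * k) = f (u, x, v)"
          by auto
        then show "window \<sigma> j k \<in> S \<and> window \<sigma> (j + t * k) k \<in> S"
          using len[of u x v] w by (auto simp: f_def X_def)
      next
        assume "window \<sigma> j k \<in> S \<and> window \<sigma> (j + t * k) k \<in> S"
        then show "window \<sigma> j ((t + 1) * k) \<in> f ` X"
          unfolding w by (intro imageI) (simp add: X_def window_in_words[OF dig])
      qed
    qed
    then have eq: "e j * e (j + t * k) = of_bool (window \<sigma> j ((t + 1) * k) \<in> f ` X)" for j
      by (simp add: e_def)
    \<comment> \<open>The free gap contributes \<open>d ^ ((t - 1) * k)\<close> to the count and to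
      the number of all words alike, so it cancels.\<close>
    have "card (f ` X) = card S * d ^ ((t - 1) * k) * card S"
      by (simp add: card_image[OF inj]) (simp add: X_def card_cartesian_product card_words)
    moreover have "real d ^ ((t + 1) * k) = real d ^ k * (real d ^ ((t - 1) * k) * real d ^ k)"
      by (metis power_add tk(1))
    ultimately have "real (card (f ` X)) / real d ^ ((t + 1) * k) = q * q"
      using d by (simp add: q_def)
    moreover have "(avg (\<lambda>j. of_bool (window \<sigma> j ((t + 1) * k) \<in> f ` X)))
        \<longlonglongrightarrow> real (card (f ` X)) / real d ^ ((t + 1) * k)"
      by (rule normal_seq_avg_window[OF \<sigma> _ sub]) (use k in simp)
    ultimately show ?thesis by (simp add: eq)
  qed
  have "(avg (\<lambda>i. e (m + i * k) + - q)) \<longlonglongrightarrow> 0"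
  proof (rule avg_progression_tendsto_0[of "\<lambda>j. e j + - q"])
    show "\<bar>e j + - q\<bar> \<le> 1" for j
      using q by (auto simp: e_def)
    show "(avg (\<lambda>j. (e j + - q) * (e (j + t * k) + - q))) \<longlonglongrightarrow> 0" if "t \<ge> 1" for t
    proof -
      \<comment> \<open>The expanded product has four terms with known limits; the shift by
        \<open>t * k\<close> does not change the limit of \<open>avg e\<close>.\<close>
      have "(avg (\<lambda>j. e j * e (j + t * k) + (- q * e j + (- q * e (j + t * k) + q * q))))
          \<longlonglongrightarrow> q * q + (- q * q + (- q * q + q * q))"
        by (intro avg_add_tendsto avg_cmult_tendsto avg_const_tendsto avg_shift_tendsto e
            pair[OF that])
      then show ?thesis by (simp add: algebra_simps)
    qed
  qed fact
  then have "(avg (\<lambda>i. (e (m + i * k) + - q) + q)) \<longlonglongrightarrow> 0 + q"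
    by (rule avg_add_tendsto[OF _ avg_const_tendsto])
  then show ?thesis by (simp add: e_def q_def)
qed

text \<open>The letters of a preimage of \<open>v\<close> are chosen independently: the preimages of
  \<open>a # v\<close> are the pairs of a preimage of \<open>a\<close> and one of
  \<open>v\<close>.\<close>

lemma card_words_map_eq:
  "real (card {u \<in> words d (length v). map g u = v}) = (\<Prod>j<length v. real (card {c. c < d \<and> g c = v ! j}))"
proof (induction v)
  case Nil
  have "{u \<in> words d (length []). map g u = []} = {[]}"
    by (auto simp: words_def)
  then show ?case by simp
next
  case (Cons a v)
  have "{u \<in> words d (length (a # v)). map g u = a # v}
      = (\<lambda>(c, u). c # u) ` ({c. c < d \<and> g c = a} \<times> {u \<in> words d (length v). map g u = v})"
    by (auto simp: words_def image_iff length_Suc_conv)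
  then have "card {u \<in> words d (length (a # v)). map g u = a # v}
      = card {c. c < d \<and> g c = a} * card {u \<in> words d (length v). map g u = v}"
    by (simp add: card_image inj_on_def card_cartesian_product)
  then show ?case
    using Cons by (simp add: prod.lessThan_Suc_shift del: prod.lessThan_Suc)
qed

section \<open>Blocks as base-\<open>n\<close> numerals\<close>

definition block_value :: "nat \<Rightarrow> nat list \<Rightarrow> nat" where
  "block_value n w = foldl (\<lambda>v a. n * v + a) 0 w"

lemma block_value_Nil [simp]: "block_value n [] = 0"
  by (simp add: block_value_def)

lemma block_value_snoc [simp]: "block_value n (w @ [a]) = n * block_value n w + a"
  by (simp add: block_value_def)

lemma length_padded_digits [simp]: "length (padded_digits n k e) = k"
  by (simp add: padded_digits_def)

text \<open>Splitting off the least significant digit matches \<open>block_value_snoc\<close>, so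
  that \<open>padded_digits\<close> and \<open>block_value\<close> are shown to be mutually inverse
  by induction from the right.\<close>

lemma padded_digits_Suc: "padded_digits n (Suc k) e = padded_digits n k (e div n) @ [e mod n]"
  by (intro nth_equalityI)
     (auto simp: padded_digits_def nth_append less_Suc_eq div_mult2_eq[symmetric]
       simp flip: power_Suc Suc_diff_Suc)

lemma padded_digits_block_value:
  "set w \<subseteq> {..<n} \<Longrightarrow> padded_digits n (length w) (block_value n w) = w"
proof (induction w rule: rev_induct)
  case Nil
  then show ?case by (simp add: padded_digits_def)
next
  case (snoc a w)
  then show ?case by (simp add: padded_digits_Suc)
qed

lemma block_value_padded_digits: "e < n ^ k \<Longrightarrow> block_value n (padded_digits n k e) = e"
proof (induction k arbitrary: e)
  case 0
  then show ?case by (simp add: padded_digits_def)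
next
  case (Suc k)
  then have "e div n < n ^ k" by (simp add: less_mult_imp_div_less mult.commute)
  with Suc.IH show ?case by (simp add: padded_digits_Suc)
qed

lemma block_value_less: "set w \<subseteq> {..<n} \<Longrightarrow> block_value n w < n ^ length w"
proof (induction w rule: rev_induct)
  case (snoc a w)
  then have "Suc (block_value n w) \<le> n ^ length w" "a < n" by auto
  then have "n * Suc (block_value n w) \<le> n * n ^ length w" by (intro mult_left_mono) auto
  with \<open>a < n\<close> show ?case by simp
qed simp

text \<open>Connects numerals with radix series. It serves both to merge \<open>k\<close>
  base-\<open>n\<close> digits into one base-\<open>n ^ k\<close> digit and to recognise the first
  \<open>m\<close> digits as an integer part.\<close>

lemma real_block_value:
  "n > 0 \<Longrightarrow> real (block_value n w) = real n ^ length w * (\<Sum>j<length w. real (w ! j) / real n ^ Suc j)"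
proof (induction w rule: rev_induct)
  case (snoc a w)
  have "(\<Sum>j<length w. real ((w @ [a]) ! j) / real n ^ Suc j) = (\<Sum>j<length w. real (w ! j) / real n ^ Suc j)"
    by (intro sum.cong) (auto simp: nth_append)
  with snoc show ?case by (simp add: distrib_left)
qed simp

section \<open>Radix expansions and fractional parts\<close>

lemma radix_max_digit_sums: "B \<ge> 2 \<Longrightarrow> (\<lambda>i. real (B - 1) / real B ^ Suc i) sums 1"
proof -
  assume "B \<ge> 2"
  then have "(\<lambda>i. (real (B - 1) / real B) * (1 / real B) ^ i) sums (real (B - 1) / real B * (1 / (1 - 1 / real B)))"
    by (intro sums_mult geometric_sums) simp
  moreover have "real (B - 1) / real B * (1 / (1 - 1 / real B)) = 1"
    using \<open>B \<ge> 2\<close> by (simp add: field_simps of_nat_diff)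
  ultimately have "(\<lambda>i. (real (B - 1) / real B) * (1 / real B) ^ i) sums 1"
    by (simp only:)
  then show ?thesis by (simp add: power_divide)
qed

lemma digit_seq_le: "digit_seq B s \<Longrightarrow> s i \<le> B - 1"
  unfolding digit_seq_def by (drule spec[of _ i]) linarith

lemma digit_seq_summable:
  assumes "n \<ge> 2" "digit_seq n x"
  shows "summable (\<lambda>i. real (x i) / real n ^ Suc i)"
proof (rule summable_comparison_test')
  show "summable (\<lambda>i. real (n - 1) / real n ^ Suc i)"
    using radix_max_digit_sums[OF assms(1)] by (rule sums_summable)
  show "norm (real (x i) / real n ^ Suc i) \<le> real (n - 1) / real n ^ Suc i" if "i \<ge> 0" for i
    using digit_seq_le[OF assms(2), of i] by (auto intro!: divide_right_mono)
qed

text \<open>Termwise comparison with the all-\<open>B - 1\<close> expansion of 1, strict at position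
  \<open>i\<close>.\<close>

lemma digit_seq_sums_less_1:
  assumes "B \<ge> 2" "digit_seq B s" "(\<lambda>i. real (s i) / real B ^ Suc i) sums y" "s i \<noteq> B - 1"
  shows "y < 1"
proof -
  let ?f = "\<lambda>i. real (B - 1) / real B ^ Suc i - real (s i) / real B ^ Suc i"
  have f: "?f sums (1 - y)"
    by (intro sums_diff radix_max_digit_sums assms)
  have le: "s i \<le> B - 1" for i
    by (rule digit_seq_le) fact
  then have "0 \<le> ?f i" for i
    by (auto simp: divide_right_mono)
  moreover have "0 < ?f i"
    using le[of i] assms(1,4) by (auto intro!: divide_strict_right_mono)
  ultimately have "0 < suminf ?f"
    using f by (intro suminf_pos2) (auto dest: sums_summable)
  with f show ?thesis by (simp add: sums_iff)
qed

text \<open>Multiplying by \<open>n ^ m\<close> turns the first \<open>m\<close> digits into an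
  integer and leaves the tail \<open>y\<close>. Grouping the tail by \<open>k\<close> digits gives
  the base-\<open>n ^ k\<close> digits \<open>s\<close>; a nonmaximal one forces
  \<open>y < 1\<close>, so \<open>y\<close> is the fractional part.\<close>

lemma radix_expansion_frac_real_of_digits:
  fixes m :: nat
  assumes n: "n \<ge> 2" and k: "k \<ge> 1" and x: "digit_seq n x"
  defines "s \<equiv> \<lambda>i. block_value n (window x (m + i * k) k)"
  assumes inf: "infinite {i. s i \<noteq> n ^ k - 1}"
  shows "radix_expansion (n ^ k) (frac (real n ^ m * real_of_digits n x)) s"
proof -
  define y where "y = (\<Sum>i. real (x (i + m)) / real n ^ Suc i)"
  have B: "n ^ k \<ge> 2"
    using n k self_le_power[of n k] by linarith
  have win: "set (window x j L) \<subseteq> {..<n}" for j L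
    using window_in_words[OF x] by (simp add: words_def)
  have s: "digit_seq (n ^ k) s"
    unfolding s_def digit_seq_def using block_value_less[OF win] by simp
  have "(\<lambda>i. real (x (i + m)) / real n ^ Suc i) sums y"
    unfolding y_def
    by (intro summable_sums digit_seq_summable n) (use x in \<open>auto simp: digit_seq_def\<close>)
  then have "(\<lambda>i. \<Sum>j = i * k..<i * k + k. real (x (j + m)) / real n ^ Suc j) sums y"
    by (rule sums_group) (use k in simp)
  moreover have "(\<Sum>j = i * k..<i * k + k. real (x (j + m)) / real n ^ Suc j)
      = real (s i) / real (n ^ k) ^ Suc i" for i
  proof -
    have "(\<Sum>j = i * k..<i * k + k. real (x (j + m)) / real n ^ Suc j)
        = (\<Sum>j<k. real (x (m + i * k + j)) / real n ^ Suc (i * k + j))"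
      by (rule sum.reindex_bij_witness[of _ "\<lambda>j. i * k + j" "\<lambda>j. j - i * k"]) (auto simp: algebra_simps)
    \<comment> \<open>The common factor \<open>n ^ (i * k)\<close> is the place value of the whole
      group.\<close>
    also have "\<dots> = (\<Sum>j<k. real (x (m + i * k + j)) / real n ^ Suc j) / real n ^ (i * k)"
      by (simp add: sum_divide_distrib power_add mult_ac)
    also have "\<dots> = real (s i) / real (n ^ k) ^ Suc i"
      using n by (simp add: s_def real_block_value power_mult mult.commute[of i k])
    finally show ?thesis .
  qed
  ultimately have sums: "(\<lambda>i. real (s i) / real (n ^ k) ^ Suc i) sums y"
    by simp
  obtain i where "s i \<noteq> n ^ k - 1"
    using inf not_finite_existsD by blast
  then have "y < 1" by (rule digit_seq_sums_less_1[OF B s sums])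
  moreover have "0 \<le> y"
    by (rule sums_le[OF _ sums_zero sums]) simp
  moreover have "real n ^ m * real_of_digits n x = real (block_value n (window x 0 m)) + y"
  proof -
    have sm: "summable (\<lambda>i. real (x i) / real n ^ Suc i)"
      by (intro digit_seq_summable n x)
    have "real_of_digits n x
        = (\<Sum>i. real (x (i + m)) / real n ^ Suc (i + m)) + (\<Sum>i<m. real (x i) / real n ^ Suc i)"
      unfolding real_of_digits_def by (rule suminf_split_initial_segment[OF sm])
    also have "(\<Sum>i. real (x (i + m)) / real n ^ Suc (i + m)) = y / real n ^ m"
      unfolding y_def
      by (subst suminf_divide[symmetric])
         (use x n in \<open>auto simp: digit_seq_def power_add mult_ac intro!: digit_seq_summable[of n "\<lambda>i. x (i + m)", simplified]\<close>)
    finally show ?thesis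
      using n by (simp add: real_block_value distrib_left)
  qed
  ultimately have "frac (real n ^ m * real_of_digits n x) = y"
    by (simp add: frac_unique_iff)
  with s sums inf show ?thesis
    by (simp add: radix_expansion_def)
qed

text \<open>A finite set has density 0, as its counts stay bounded. This serves to exclude
  expansions ending in maximal digits.\<close>

lemma infinite_if_avg_pos:
  assumes "(avg (\<lambda>i. of_bool (P i))) \<longlonglongrightarrow> q" "q > 0"
  shows "infinite {i. P i}"
proof
  assume fin: "finite {i. P i}"
  have "(avg (\<lambda>i. of_bool (P i))) \<longlonglongrightarrow> 0"
  proof (rule tendsto_sandwich[OF _ _ tendsto_const lim_const_over_n])
    show "\<forall>\<^sub>F N in sequentially. 0 \<le> avg (\<lambda>i. of_bool (P i)) N"
      by (simp add: avg_of_bool)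
    show "\<forall>\<^sub>F N in sequentially. avg (\<lambda>i. of_bool (P i)) N \<le> real (card {i. P i}) / real N"
      using fin by (auto simp: avg_of_bool intro!: always_eventually divide_right_mono card_mono)
  qed
  with assms LIMSEQ_unique show False by blast
qed

section \<open>Letter counts in the bias block and the conclusion\<close>

lemma card_nth_bias_block:
  "card {c. c < length (bias_block n p d) \<and> bias_block n p d ! c = i}
     = (if i < n then nat \<lfloor>p i * real d\<rfloor> else 0)"
proof -
  have replicate: "count_list (replicate l j) i = (if i = j then l else 0)" for l j :: nat
    by (induction l) auto
  \<comment> \<open>Counts add up over the concatenated runs, and only the run of \<open>i\<close>
    contributes.\<close>
  have "count_list (bias_block n p d) i = (\<Sum>j<n. if i = j then nat \<lfloor>p j * real d\<rfloor> else 0)"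
    by (simp add: bias_block_def count_list_concat comp_def replicate
        sum_list_distinct_conv_sum_set atLeast0LessThan)
  then show ?thesis
    by (simp add: count_list_eq_length_filter length_filter_conv_card eq_commute)
qed

theorem theorem3p3:
  fixes n d :: nat and p :: "nat \<Rightarrow> real" and a b :: "nat \<Rightarrow> nat"
    and g :: "nat list" and \<nu> \<beta> :: "nat \<Rightarrow> nat"
  assumes "n \<ge> 2"
    and "\<And>i. i < n \<Longrightarrow> p i \<in> \<rat> \<and> p i > 0"
    and "(\<Sum>i<n. p i) = 1"
    and "\<And>i. i < n \<Longrightarrow> b i > 0 \<and> coprime (a i) (b i) \<and> p i = real (a i) / real (b i)"
    and "d = Lcm (b ` {..<n})"
    and "g = bias_block n p d"
    and "normal_seq d \<nu>"
    and "\<And>k. \<beta> k = g ! (\<nu> k)"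
  shows "biased_normal n p \<beta>"
proof -
  have dig: "digit_seq d \<nu>" using assms(7) by (simp add: normal_seq_def)
  then have "d > 0" by (auto simp: digit_seq_def intro: gr_zeroI)
  \<comment> \<open>The floor is exact because the denominator \<open>b i\<close> divides
    \<open>d\<close>.\<close>
  have pd: "real (nat \<lfloor>p i * real d\<rfloor>) = p i * real d" if "i < n" for i
  proof -
    have "b i dvd d" using that assms(5) by auto
    then obtain c where "d = b i * c" ..
    then have "p i * real d = real (a i * c)" using assms(4)[OF that] by simp
    then show ?thesis by (metis floor_of_nat nat_int)
  qed
  \<comment> \<open>Since the biases sum to 1, \<open>g\<close> has length exactly \<open>d\<close>,
    so every lookup \<open>g ! (\<nu> k)\<close> is within bounds.\<close>
  have "real (length g) = (\<Sum>i<n. real (nat \<lfloor>p i * real d\<rfloor>))"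
    by (simp add: assms(6) bias_block_def length_concat comp_def sum_list_distinct_conv_sum_set
        atLeast0LessThan del: of_nat_nat)
  also have "\<dots> = (\<Sum>i<n. p i) * real d"
    by (simp add: pd sum_distrib_right)
  finally have len: "length g = d"
    using assms(3) by simp
  have "set g \<subseteq> {..<n}"
    by (auto simp: assms(6) bias_block_def)
  with len have g_less: "g ! c < n" if "c < d" for c
    using that by (metis lessThan_iff nth_mem subsetD)
  have dig\<beta>: "digit_seq n \<beta>"
    using dig g_less by (simp add: digit_seq_def assms(8))
  have "biased_simply_normal (n ^ k) (block_bias n p k) (real n ^ m * real_of_digits n \<beta>)"
    if k: "k \<ge> 1" for m k
  proof -
    define s where "s = (\<lambda>i. block_value n (window \<beta> (m + i * k) k))"
    have freq: "(avg (\<lambda>i. of_bool (s i = e))) \<longlonglongrightarrow> block_bias n p k e" if e: "e < n ^ k" for e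
    proof -
      \<comment> \<open>\<open>S\<close> collects the blocks of \<open>\<nu>\<close> that
        \<open>g\<close> turns into the numeral of \<open>e\<close>, which moves the frequency
        question from \<open>\<beta>\<close> to \<open>\<nu>\<close>.\<close>
      define S where "S = {u \<in> words d k. map ((!) g) u = padded_digits n k e}"
      have "s i = e \<longleftrightarrow> window \<nu> (m + i * k) k \<in> S" for i
      proof -
        have "s i = e \<longleftrightarrow> window \<beta> (m + i * k) k = padded_digits n k e"
          using padded_digits_block_value[of "window \<beta> (m + i * k) k" n]
            window_in_words[OF dig\<beta>, of "m + i * k" k] block_value_padded_digits[OF e]
          by (auto simp: s_def words_def)
        moreover have "window \<beta> (m + i * k) k = map ((!) g) (window \<nu> (m + i * k) k)"
          by (simp add: window_def assms(8))
        ultimately show ?thesis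
          using window_in_words[OF dig] by (simp add: S_def)
      qed
      moreover have "real (card S) / real d ^ k = block_bias n p k e"
      proof -
        \<comment> \<open>Each letter has \<open>p * d\<close> preimages; over \<open>k\<close>
          letters the factors \<open>d\<close> cancel against \<open>d ^ k\<close>.\<close>
        have "real (card {c. c < d \<and> g ! c = padded_digits n k e ! j}) = p (padded_digits n k e ! j) * real d"
          if "j < k" for j
          using that assms(1) card_nth_bias_block[of n p d] len pd
          by (simp add: assms(6)[symmetric] padded_digits_def)
        then have "real (card S) = (\<Prod>j<k. p (padded_digits n k e ! j) * real d)"
          unfolding S_def using card_words_map_eq[of d "padded_digits n k e" "(!) g"] by simp
        then show ?thesis
          using \<open>d > 0\<close> by (simp add: block_bias_def prod.distrib)
      qed
      moreover have "S \<subseteq> words d k" by (auto simp: S_def)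
      ultimately show ?thesis
        using normal_seq_avg_window_progression[OF assms(7) k, of S m] by simp
    qed
    \<comment> \<open>Digit 0 has positive limiting frequency because \<open>p 0 > 0\<close>, and it
      differs from \<open>n ^ k - 1\<close>. Hence \<open>s\<close> does not end in maximal digits
      and is the required expansion.\<close>
    have "n ^ k > 1" using assms(1) k self_le_power[of n k] by linarith
    moreover have "block_bias n p k 0 > 0"
      using assms(1,2) by (auto simp: block_bias_def padded_digits_def intro!: prod_pos)
    ultimately have "infinite {i. s i = 0}"
      using assms(1) by (intro infinite_if_avg_pos[OF freq[of 0]]) simp_all
    then have "infinite {i. s i \<noteq> n ^ k - 1}"
      by (rule infinite_super[rotated]) (use \<open>n ^ k > 1\<close> in auto)
    then have "radix_expansion (n ^ k) (frac (real n ^ m * real_of_digits n \<beta>)) s"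
      unfolding s_def by (rule radix_expansion_frac_real_of_digits[OF assms(1) k dig\<beta>])
    then show ?thesis
      using freq unfolding biased_simply_normal_def by (auto simp: avg_of_bool[abs_def])
  qed
  with dig\<beta> show ?thesis by (simp add: biased_normal_def)
qed

end
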